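(* Let $(G,\alpha)$ be a weighted graph with expansion $(H,\beta)$. Let $E'$ be a multiset of edges on the vertices of $H$ such that for each pair of vertices $a,b$ of $H$, we have that $a$ and $b$ are in the same connected component of the graph $(V(H),E')$ if and only if $aRb$. Then $$X_{(G,\alpha)}=\sum_{S\subseteq E'}(-1)^{|S|} X_{(H+S,\beta)}.$$
   Context: Graphs are finite; loops and multiple edges are allowed, so the edges $E(G)$ form a finite multiset. A composition is a finite ordered list of positive integers (its parts). A composition $\beta$ is a refinement of $\alpha$ (equivalently, $\alpha$ is a coarsening of $\beta$; written $\beta\preccurlyeq\alpha$) if the parts of $\alpha$ are obtained in order by adding together adjacent parts of $\beta$ in order. Weighted graphs: for a graph $G$ with labelled (ordered) vertices $v_1,\dots,v_N$ and a composition $\alpha=(\alpha_1,\dots,\alpha_N)$, $(G,\alpha)$ denotes the weighted graph in which $v_i$ has weight $\alpha_i$. A proper colouring is a map $\kappa:V(G)\to\mathbb{Z}^+$ with $\kappa(u)\ne\kappa(v)$ whenever there is an edge $uv$ (so a graph with a loop has none). The extended chromatic symmetric function is $$X_{(G,\alpha)}=\sum_\kappa x_{\kappa(v_1)}^{\alpha_1}\cdots x_{\kappa(v_N)}^{\alpha_N},$$ summed over all proper colourings $\kappa$ of $G$. Relation $R$: given weighted graphs $(G,\alpha)$ and $(H,\beta)$ with $\beta\preccurlyeq\alpha$, for a vertex $v$ of $G$ let $R(v)$ be the set of consecutively labelled vertices of $H$ whose weights are summed to obtain the weight of $v$ when describing $\alpha$ as a coarsening of $\beta$. For vertices $a,b$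 of $H$, write $aRb$ if and only if there is a vertex $v$ of $G$ with $a,b\in R(v)$. Expansion: $(H,\beta)$ is an expansion of $(G,\alpha)$ if (1) $\beta$ is a refinement of $\alpha$, and (2) for all pairs of vertices $u,v$ (not necessarily distinct) of $G$, there is an edge $uv$ in $E(G)$ if and only if there exists an edge $ab$ in $E(H)$ with $a\in R(u)$ and $b\in R(v)$. $H+S$ is the graph $(V(H),E(H)+S)$ obtained by adding the edges in $S$ to the edge multiset of $H$ (with the same vertex labelling). The sum over $S\subseteq E'$ treats parallel edges of $E'$ as distinguishable, so it has $2^{|E'|}$ terms. *)

theory Defs
  imports "HOL-Library.Uprod" "HOL-Library.Multiset" "HOL-Library.Poly_Mapping"
    "HOL-Library.FuncSet"
begin

(* A finite graph with ordered vertices v_1, ..., v_N: the vertex list is (v_1, ..., v_N)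
   (indexed from 0 by nth).  An edge is an unordered pair Upair u v; u = v is a loop. *)
record 'v lgraph =
  vlist :: "'v list"
  edges :: "'v uprod multiset"

abbreviation verts :: "'v lgraph \<Rightarrow> 'v set" where
  "verts G \<equiv> set (vlist G)"

definition edges_on :: "'v set \<Rightarrow> 'v uprod multiset \<Rightarrow> bool" where
  "edges_on V E \<longleftrightarrow> (\<forall>e\<in>#E. set_uprod e \<subseteq> V)"

definition graph :: "'v lgraph \<Rightarrow> bool" where
  "graph G \<longleftrightarrow> distinct (vlist G) \<and> edges_on (verts G) (edges G)"

definition add_edges :: "'v lgraph \<Rightarrow> 'v uprod multiset \<Rightarrow> 'v lgraph" where
  "add_edges H S = H\<lparr>edges := edges H + S\<rparr>"

definition same_component :: "'v lgraph \<Rightarrow> 'v \<Rightarrow> 'v \<Rightarrow> bool" where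
  "same_component G a b \<longleftrightarrow>
     a \<in> verts G \<and> b \<in> verts G \<and> (a, b) \<in> {(u, v). Upair u v \<in># edges G}\<^sup>*"

definition composition :: "nat list \<Rightarrow> bool" where
  "composition \<alpha> \<longleftrightarrow> (\<forall>k\<in>set \<alpha>. 0 < k)"

definition weighted_graph :: "'v lgraph \<Rightarrow> nat list \<Rightarrow> bool" where
  "weighted_graph G \<alpha> \<longleftrightarrow> graph G \<and> composition \<alpha> \<and> length \<alpha> = length (vlist G)"

(* bs cuts \<beta> into consecutive nonempty blocks whose sums are, in order, the parts of \<alpha>. *)
definition coarsening_blocks :: "nat list list \<Rightarrow> nat list \<Rightarrow> nat list \<Rightarrow> bool" where
  "coarsening_blocks bs \<beta> \<alpha> \<longleftrightarrow>
     concat bs = \<beta> \<and> map sum_list bs = \<alpha> \<and> [] \<notin> set bs"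

definition refines :: "nat list \<Rightarrow> nat list \<Rightarrow> bool" (infix "\<preceq>\<^sub>c" 50) where
  "\<beta> \<preceq>\<^sub>c \<alpha> \<longleftrightarrow> (\<exists>bs. coarsening_blocks bs \<beta> \<alpha>)"

(* The blocks are determined by the two compositions, so the existential quantifier over bs
   in R_set below involves no choice. *)
lemma coarsening_blocks_unique:
  assumes "composition \<beta>" "coarsening_blocks bs \<beta> \<alpha>" "coarsening_blocks cs \<beta> \<alpha>"
  shows "bs = cs"
proof -
  have pre: "xs = ys"
    if "xs @ us = ys @ vs" "sum_list xs = sum_list ys" "\<forall>k\<in>set (xs @ us). 0 < k"
    for xs ys us vs :: "nat list"
    using that
  proof (induction xs arbitrary: ys)
    case Nil
    then show ?case by (cases ys) auto
  next
    case (Cons x xs)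
    then show ?case by (cases ys) auto
  qed
  have "bs = cs" if "concat bs = concat cs" "map sum_list bs = map sum_list cs"
    "\<forall>k\<in>set (concat bs). 0 < k" for bs cs :: "nat list list"
    using that
  proof (induction bs arbitrary: cs)
    case Nil
    then show ?case by simp
  next
    case (Cons b bs)
    then obtain c cs' where cs: "cs = c # cs'" by (cases cs) auto
    have "b = c"
      by (rule pre[of b "concat bs" c "concat cs'"]) (use Cons.prems cs in auto)
    then show ?case using Cons cs by auto
  qed
  then show ?thesis
    using assms unfolding coarsening_blocks_def composition_def by metis
qed

(* R(v): if v is the i-th vertex of G, the vertices of H at the positions of the i-th block. *)
definition R_set ::
  "'v lgraph \<Rightarrow> nat list \<Rightarrow> 'w lgraph \<Rightarrow> nat list \<Rightarrow> 'v \<Rightarrow> 'w set" where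
  "R_set G \<alpha> H \<beta> v =
     {vlist H ! j | bs i j. coarsening_blocks bs \<beta> \<alpha> \<and> i < length (vlist G) \<and> vlist G ! i = v \<and>
        length (concat (take i bs)) \<le> j \<and> j < length (concat (take (Suc i) bs))}"

definition R_rel ::
  "'v lgraph \<Rightarrow> nat list \<Rightarrow> 'w lgraph \<Rightarrow> nat list \<Rightarrow> 'w \<Rightarrow> 'w \<Rightarrow> bool" where
  "R_rel G \<alpha> H \<beta> a b \<longleftrightarrow> (\<exists>v\<in>verts G. a \<in> R_set G \<alpha> H \<beta> v \<and> b \<in> R_set G \<alpha> H \<beta> v)"

definition expansion ::
  "'w lgraph \<Rightarrow> nat list \<Rightarrow> 'v lgraph \<Rightarrow> nat list \<Rightarrow> bool" where
  "expansion H \<beta> G \<alpha> \<longleftrightarrow>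
     \<beta> \<preceq>\<^sub>c \<alpha> \<and>
     (\<forall>u\<in>verts G. \<forall>v\<in>verts G.
        Upair u v \<in># edges G \<longleftrightarrow>
        (\<exists>a\<in>R_set G \<alpha> H \<beta> u. \<exists>b\<in>R_set G \<alpha> H \<beta> v. Upair a b \<in># edges H))"

(* Colourings are extensional functions, so that each map V(G) \<rightarrow> {1, 2, ...} occurs once. *)
definition proper_colourings :: "'v lgraph \<Rightarrow> ('v \<Rightarrow> nat) set" where
  "proper_colourings G =
     {\<kappa> \<in> verts G \<rightarrow>\<^sub>E {1..}. \<forall>u v. Upair u v \<in># edges G \<longrightarrow> \<kappa> u \<noteq> \<kappa> v}"

(* A monomial in x_1, x_2, ... is represented by its finitely supported exponent function. *)
definition colouring_monomial ::
  "'v lgraph \<Rightarrow> nat list \<Rightarrow> ('v \<Rightarrow> nat) \<Rightarrow> (nat \<Rightarrow>\<^sub>0 nat)" where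
  "colouring_monomial G \<alpha> \<kappa> =
     (\<Sum>i<length (vlist G). Poly_Mapping.single (\<kappa> (vlist G ! i)) (\<alpha> ! i))"

(* A formal power series in x_1, x_2, ... is represented by its coefficient function on monomials.
   The coefficient of m in the sum over all proper colourings is the number of
   colourings whose monomial is m, which is finite (next lemma) because weights are positive. *)
definition chromatic_sf :: "'v lgraph \<Rightarrow> nat list \<Rightarrow> (nat \<Rightarrow>\<^sub>0 nat) \<Rightarrow> int" where
  "chromatic_sf G \<alpha> m =
     int (card {\<kappa> \<in> proper_colourings G. colouring_monomial G \<alpha> \<kappa> = m})"

lemma finite_colourings_of_monomial:
  assumes "weighted_graph G \<alpha>"
  shows "finite {\<kappa> \<in> proper_colourings G. colouring_monomial G \<alpha> \<kappa> = m}"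
proof (rule finite_subset)
  show "finite (verts G \<rightarrow>\<^sub>E Poly_Mapping.keys m)"
    by (intro finite_PiE finite_keys finite_set)
  show "{\<kappa> \<in> proper_colourings G. colouring_monomial G \<alpha> \<kappa> = m} \<subseteq> verts G \<rightarrow>\<^sub>E Poly_Mapping.keys m"
  proof
    fix \<kappa> assume k: "\<kappa> \<in> {\<kappa> \<in> proper_colourings G. colouring_monomial G \<alpha> \<kappa> = m}"
    have "\<kappa> v \<in> Poly_Mapping.keys m" if v: "v \<in> verts G" for v
    proof -
      obtain i where i: "i < length (vlist G)" "vlist G ! i = v"
        using v by (meson in_set_conv_nth)
      have "0 < \<alpha> ! i"
        using assms i by (simp add: weighted_graph_def composition_def)
      also have "\<alpha> ! i = Poly_Mapping.lookup (Poly_Mapping.single (\<kappa> (vlist G ! i)) (\<alpha> ! i)) (\<kappa> v)"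
        using i by simp
      also have "\<dots> \<le> (\<Sum>j<length (vlist G).
          Poly_Mapping.lookup (Poly_Mapping.single (\<kappa> (vlist G ! j)) (\<alpha> ! j)) (\<kappa> v))"
        using i(1) by (intro member_le_sum) auto
      also have "\<dots> = Poly_Mapping.lookup (colouring_monomial G \<alpha> \<kappa>) (\<kappa> v)"
        by (simp add: colouring_monomial_def lookup_sum)
      finally show ?thesis using k by (simp add: in_keys_iff)
    qed
    then show "\<kappa> \<in> verts G \<rightarrow>\<^sub>E Poly_Mapping.keys m"
      using k by (auto simp: proper_colourings_def PiE_iff)
  qed
qed

(* The elements of a multiset made distinguishable: (e, i) is the i-th copy of e.  Subsets of
   copies E are the 2^|E| subsets of E in which parallel edges are told apart. *)
definition copies :: "'a multiset \<Rightarrow> ('a \<times> nat) set" where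
  "copies E = (SIGMA e : set_mset E. {..<count E e})"

definition uncopy :: "('a \<times> nat) set \<Rightarrow> 'a multiset" where
  "uncopy S = image_mset fst (mset_set S)"

lemma finite_copies: "finite (copies E)"
  by (simp add: copies_def)

lemma card_copies: "card (copies E) = size E"
  by (simp add: copies_def size_multiset_overloaded_eq)

lemma uncopy_copies: "uncopy (copies E) = E"
proof (rule multiset_eqI)
  fix x
  have "count (uncopy (copies E)) x = card {p \<in> copies E. fst p = x}"
    unfolding uncopy_def count_image_mset using finite_copies[of E]
    by (subst card_eq_sum, intro sum.cong) auto
  also have "{p \<in> copies E. fst p = x} = Pair x ` {..<count E x}"
    by (auto simp: copies_def image_iff simp flip: count_greater_zero_iff)
  also have "card \<dots> = count E x"
    by (simp add: card_image inj_on_def)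
  finally show "count (uncopy (copies E)) x = count E x" .
qed

end

theory Submission
  imports Defs
begin

text \<open>
  Exchange the two sums on the right-hand side. A proper colouring of \<open>H\<close> is counted with weight
  \<open>\<Sum>(-1)^card S\<close> over the sets \<open>S\<close> of edges of \<open>E'\<close> that it does not make monochromatic, and this
  vanishes unless every edge of \<open>E'\<close> is monochromatic. The surviving colourings are constant on the
  components of \<open>E'\<close>, i.e. on the blocks \<open>R(v)\<close>, and are the pullbacks of the proper
  colourings of \<open>G\<close>.
\<close>

section \<open>Alternating sums over subsets, and copies of edges\<close>

lemma sum_Pow_minus_one_power_card:
  assumes "finite A"
  shows "(\<Sum>S\<in>Pow A. (-1) ^ card S) = (if A = {} then 1 else (0 :: 'a :: comm_ring_1))"
  \<comment> \<open>Expanding the product over \<open>A\<close> of the factors \<open>1 - 1\<close>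
    gives the signed sum, so its value is \<open>0 ^ card A\<close>.\<close>
  using prod_diff_conv_sum[OF assms, of "\<lambda>_. 1 :: 'a" "\<lambda>_. 1"] assms by (auto simp: power_0_left)

text \<open>Finiteness matters because \<open>mset_set\<close> sends infinite sets to the empty
  multiset.\<close>

lemma set_mset_uncopy:
  assumes "finite S"
  shows "set_mset (uncopy S) = fst ` S"
  using assms by (simp add: uncopy_def)

lemma fst_copies: "fst ` copies E = set_mset E"
  by (metis set_mset_uncopy[OF finite_copies] uncopy_copies)

section \<open>Positions and sums in a list cut into consecutive blocks\<close>

lemma length_concat_take_Suc:
  assumes "i < length bs"
  shows "length (concat (take (Suc i) bs)) = length (concat (take i bs)) + length (bs ! i)"
  using assms by (simp add: take_Suc_conv_app_nth)

lemma length_concat_take_mono: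
  assumes "i \<le> j"
  shows "length (concat (take i bs)) \<le> length (concat (take j bs))"
proof -
  have "take j bs = take i bs @ take (j - i) (drop i bs)"
    using assms by (metis le_add_diff_inverse take_add)
  then show ?thesis by simp
qed

text \<open>A sequence that starts at 0 and ends above \<open>j\<close> must cross \<open>j\<close>
  at some step. With block boundaries as \<open>s\<close>, this places each vertex of
  \<open>H\<close> in a block.\<close>

lemma mono_interval_cover:
  fixes s :: "nat \<Rightarrow> nat"
  assumes "s 0 = 0" "j < s n"
  shows "\<exists>i<n. s i \<le> j \<and> j < s (Suc i)"
  using assms(2)
proof (induction n)
  case 0
  then show ?case using assms(1) by simp
next
  case (Suc n)
  then show ?case by (cases "j < s n") (auto simp: less_Suc_eq)
qed

text \<open>Used to regroup a sum over the vertices of \<open>H\<close> as a double sum over blocks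
  and their members.\<close>

lemma sum_mono_intervals:
  fixes s :: "nat \<Rightarrow> nat"
  assumes "mono s" "s 0 = 0"
  shows "sum f {..<s n} = (\<Sum>i<n. sum f {s i..<s (Suc i)})"
proof (induction n)
  case 0
  then show ?case using assms(2) by simp
next
  case (Suc n)
  have "sum f {..<s (Suc n)} = sum f {..<s n} + sum f {s n..<s (Suc n)}"
    using monoD[OF assms(1), of n "Suc n"]
    by (subst sum.union_disjoint[symmetric]) (auto intro!: sum.cong)
  then show ?case using Suc by simp
qed

text \<open>The positions from \<open>?s\<close> up to \<open>?t\<close> in the concatenation hold
  exactly the entries of \<open>bs ! i\<close>, with indices shifted by the total length of the
  earlier blocks.\<close>

lemma sum_concat_block:
  assumes "i < length bs"
  shows "(\<Sum>j\<in>{length (concat (take i bs))..<length (concat (take (Suc i) bs))}. concat bs ! j) =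
    sum_list (bs ! i)" (is "sum _ {?s..<?t} = _")
proof -
  have cat: "concat bs = concat (take i bs) @ bs ! i @ concat (drop (Suc i) bs)"
    using id_take_nth_drop[OF assms] by (metis concat.simps(2) concat_append)
  have "(\<Sum>j\<in>{?s..<?t}. concat bs ! j) = (\<Sum>k\<in>{0..<length (bs ! i)}. concat bs ! (k + ?s))"
    using sum.shift_bounds_nat_ivl[of "\<lambda>j. concat bs ! j" 0 ?s "length (bs ! i)"]
      length_concat_take_Suc[OF assms] by (simp add: add.commute)
  also have "\<dots> = (\<Sum>k\<in>{0..<length (bs ! i)}. bs ! i ! k)"
    by (intro sum.cong refl) (subst cat, simp add: nth_append)
  finally show ?thesis by (simp add: sum_list_sum_nth)
qed

lemma single_sum: "Poly_Mapping.single k (sum f A) = (\<Sum>x\<in>A. Poly_Mapping.single k (f x))"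
  by (induction A rule: infinite_finite_induct) (simp_all add: single_add)

section \<open>The sets R(v) as a partition of the vertices of \<open>H\<close>\<close>

locale coarsened_graph =
  fixes G :: "'v lgraph" and H :: "'w lgraph" and \<alpha> \<beta> :: "nat list" and bs :: "nat list list"
  assumes wG: "weighted_graph G \<alpha>" and wH: "weighted_graph H \<beta>"
    and blocks: "coarsening_blocks bs \<beta> \<alpha>"
begin

text \<open>Block \<open>i\<close> occupies the half-open range of positions from
  \<open>start i\<close> to \<open>start (Suc i)\<close> in \<open>vlist H\<close>, counted from
  0.\<close>

definition start :: "nat \<Rightarrow> nat" where
  "start i = length (concat (take i bs))"

lemma length_bs: "length bs = length (vlist G)"
  using blocks wG by (auto simp: coarsening_blocks_def weighted_graph_def)

lemma start_0: "start 0 = 0"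
  by (simp add: start_def)

lemma mono_start: "mono start"
  by (auto simp: mono_def start_def length_concat_take_mono)

text \<open>Strictness comes from the blocks being nonempty, and makes every R(v) nonempty.\<close>

lemma start_less_Suc:
  assumes "i < length (vlist G)"
  shows "start i < start (Suc i)"
proof -
  have "bs ! i \<noteq> []"
    using assms blocks length_bs by (metis coarsening_blocks_def nth_mem)
  then show ?thesis using assms length_bs by (simp add: start_def length_concat_take_Suc)
qed

lemma start_end: "start (length (vlist G)) = length (vlist H)"
proof -
  have "start (length (vlist G)) = length (concat bs)"
    by (simp add: start_def flip: length_bs)
  then show ?thesis using blocks wH by (simp add: coarsening_blocks_def weighted_graph_def)
qed

text \<open>The quantifiers in \<open>R_set\<close> collapse: the cut is unique since the parts of
  \<beta> are positive, and the index is unique since the vertices of \<open>G\<close> are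
  distinct.\<close>

lemma R_set_nth:
  assumes "i < length (vlist G)"
  shows "R_set G \<alpha> H \<beta> (vlist G ! i) = (!) (vlist H) ` {start i..<start (Suc i)}"
proof -
  have "composition \<beta>" using wH by (simp add: weighted_graph_def)
  then have bs: "cs = bs" if "coarsening_blocks cs \<beta> \<alpha>" for cs
    using blocks coarsening_blocks_unique that by blast
  have idx: "i' = i" if "i' < length (vlist G)" "vlist G ! i' = vlist G ! i" for i'
    using assms wG that by (auto simp: weighted_graph_def graph_def nth_eq_iff_index_eq)
  show ?thesis
  proof (intro equalityI subsetI)
    fix a assume "a \<in> R_set G \<alpha> H \<beta> (vlist G ! i)"
    then obtain cs i' j where *: "a = vlist H ! j" "coarsening_blocks cs \<beta> \<alpha>"
        "i' < length (vlist G)" "vlist G ! i' = vlist G ! i"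
        "length (concat (take i' cs)) \<le> j" "j < length (concat (take (Suc i') cs))"
      unfolding R_set_def by blast
    then have "j \<in> {start i..<start (Suc i)}"
      using bs[OF *(2)] idx[OF *(3,4)] by (simp add: start_def)
    then show "a \<in> (!) (vlist H) ` {start i..<start (Suc i)}" using *(1) by blast
  next
    fix a assume "a \<in> (!) (vlist H) ` {start i..<start (Suc i)}"
    then obtain j where "a = vlist H ! j" "start i \<le> j" "j < start (Suc i)" by auto
    then show "a \<in> R_set G \<alpha> H \<beta> (vlist G ! i)"
      using blocks assms unfolding R_set_def start_def by blast
  qed
qed

lemma block_index_less:
  assumes "i < length (vlist G)" "j < start (Suc i)"
  shows "j < length (vlist H)"
  using monoD[OF mono_start, of "Suc i" "length (vlist G)"] assms start_end by simp

lemma R_set_subset: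
  assumes "v \<in> verts G"
  shows "R_set G \<alpha> H \<beta> v \<subseteq> verts H"
proof -
  obtain i where i: "i < length (vlist G)" "v = vlist G ! i"
    using assms by (metis in_set_conv_nth)
  then show ?thesis using block_index_less[OF i(1)] by (auto simp: R_set_nth)
qed

lemma R_set_nonempty:
  assumes "v \<in> verts G"
  shows "R_set G \<alpha> H \<beta> v \<noteq> {}"
proof -
  obtain i where i: "i < length (vlist G)" "v = vlist G ! i"
    using assms by (metis in_set_conv_nth)
  then show ?thesis using start_less_Suc[OF i(1)] by (simp add: R_set_nth)
qed

lemma R_set_cover:
  assumes "a \<in> verts H"
  shows "\<exists>v\<in>verts G. a \<in> R_set G \<alpha> H \<beta> v"
proof -
  obtain j where j: "j < length (vlist H)" "a = vlist H ! j"
    using assms by (metis in_set_conv_nth)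
  then obtain i where i: "i < length (vlist G)" "start i \<le> j" "j < start (Suc i)"
    using mono_interval_cover[of start j "length (vlist G)"] start_0 start_end by auto
  then have "a \<in> R_set G \<alpha> H \<beta> (vlist G ! i)" using j by (simp add: R_set_nth)
  then show ?thesis using i(1) nth_mem by blast
qed

text \<open>Since the vertices of \<open>H\<close> are distinct, a common element has a single
  position, and by monotonicity of \<open>start\<close> the ranges of two different blocks cannot
  share a position.\<close>

lemma R_set_disjoint:
  assumes "u \<in> verts G" "v \<in> verts G" "a \<in> R_set G \<alpha> H \<beta> u" "a \<in> R_set G \<alpha> H \<beta> v"
  shows "u = v"
proof -
  obtain i where i: "i < length (vlist G)" "u = vlist G ! i"
    using assms(1) by (metis in_set_conv_nth)
  obtain j where j: "j < length (vlist G)" "v = vlist G ! j"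
    using assms(2) by (metis in_set_conv_nth)
  obtain k where k: "start i \<le> k" "k < start (Suc i)" "a = vlist H ! k"
    using assms(3) unfolding i(2) R_set_nth[OF i(1)] by auto
  obtain l where l: "start j \<le> l" "l < start (Suc j)" "a = vlist H ! l"
    using assms(4) unfolding j(2) R_set_nth[OF j(1)] by auto
  have "distinct (vlist H)" using wH by (simp add: weighted_graph_def graph_def)
  then have "k = l"
    using nth_eq_iff_index_eq k(3) l(3) block_index_less[OF i(1) k(2)] block_index_less[OF j(1) l(2)]
    by metis
  have "\<not> i < j" using monoD[OF mono_start, of "Suc i" j] k(2) l(1) \<open>k = l\<close> by auto
  moreover have "\<not> j < i" using monoD[OF mono_start, of "Suc j" i] k(1) l(2) \<open>k = l\<close> by auto
  ultimately have "i = j" by simp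
  then show ?thesis using i(2) j(2) by simp
qed

text \<open>Within a block all variables coincide, so their exponents add up to the part of \<alpha>
  that the block refines.\<close>

lemma colouring_monomial_eq:
  assumes "\<And>v a. v \<in> verts G \<Longrightarrow> a \<in> R_set G \<alpha> H \<beta> v \<Longrightarrow> \<mu> a = \<kappa> v"
  shows "colouring_monomial H \<beta> \<mu> = colouring_monomial G \<alpha> \<kappa>"
proof -
  have "colouring_monomial H \<beta> \<mu> =
      (\<Sum>j<start (length (vlist G)). Poly_Mapping.single (\<mu> (vlist H ! j)) (\<beta> ! j))"
    by (simp add: colouring_monomial_def start_end)
  also have "\<dots> = (\<Sum>i<length (vlist G). \<Sum>j\<in>{start i..<start (Suc i)}.
      Poly_Mapping.single (\<mu> (vlist H ! j)) (\<beta> ! j))"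
    by (rule sum_mono_intervals[OF mono_start start_0])
  also have "\<dots> = (\<Sum>i<length (vlist G). Poly_Mapping.single (\<kappa> (vlist G ! i)) (\<alpha> ! i))"
  proof (intro sum.cong refl)
    fix i assume "i \<in> {..<length (vlist G)}"
    then have i: "i < length (vlist G)" by simp
    have "(\<Sum>j\<in>{start i..<start (Suc i)}. Poly_Mapping.single (\<mu> (vlist H ! j)) (\<beta> ! j)) =
        (\<Sum>j\<in>{start i..<start (Suc i)}. Poly_Mapping.single (\<kappa> (vlist G ! i)) (\<beta> ! j))"
      using i by (intro sum.cong refl arg_cong2[of _ _ _ _ Poly_Mapping.single] assms)
        (auto simp: R_set_nth)
    also have "\<dots> = Poly_Mapping.single (\<kappa> (vlist G ! i)) (\<Sum>j\<in>{start i..<start (Suc i)}. \<beta> ! j)"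
      by (simp add: single_sum)
    also have "(\<Sum>j\<in>{start i..<start (Suc i)}. \<beta> ! j) = \<alpha> ! i"
      using sum_concat_block[of i bs] i length_bs blocks
      by (auto simp: start_def coarsening_blocks_def)
    finally show "(\<Sum>j\<in>{start i..<start (Suc i)}.
        Poly_Mapping.single (\<mu> (vlist H ! j)) (\<beta> ! j)) =
        Poly_Mapping.single (\<kappa> (vlist G ! i)) (\<alpha> ! i)" .
  qed
  finally show ?thesis by (simp add: colouring_monomial_def)
qed

section \<open>Pulling colourings of \<open>G\<close> back to \<open>H\<close>\<close>

definition block_of :: "'w \<Rightarrow> 'v" where
  "block_of a = (THE v. v \<in> verts G \<and> a \<in> R_set G \<alpha> H \<beta> v)"

lemma block_of_eq:
  assumes "v \<in> verts G" "a \<in> R_set G \<alpha> H \<beta> v"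
  shows "block_of a = v"
  unfolding block_of_def using assms R_set_disjoint by blast

lemma block_of:
  assumes "a \<in> verts H"
  shows "block_of a \<in> verts G" "a \<in> R_set G \<alpha> H \<beta> (block_of a)"
  using R_set_cover[OF assms] block_of_eq by auto

text \<open>Thus the relation R is the kernel of the map that contracts each block to its vertex of
  \<open>G\<close>.\<close>

lemma R_rel_iff_block_of:
  assumes "a \<in> verts H" "b \<in> verts H"
  shows "R_rel G \<alpha> H \<beta> a b \<longleftrightarrow> block_of a = block_of b"
  using assms block_of block_of_eq unfolding R_rel_def by metis

text \<open>Composition with the contraction is injective because blocks are nonempty, and it
  reaches every colouring constant on blocks. The expansion condition makes properness agree on both
  sides, and monomials are preserved.\<close>

lemma bij_betw_pullback_colourings:
  assumes "expansion H \<beta> G \<alpha>"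
  shows "bij_betw (\<lambda>\<kappa>. restrict (\<kappa> \<circ> block_of) (verts H))
    {\<kappa> \<in> proper_colourings G. colouring_monomial G \<alpha> \<kappa> = m}
    {\<kappa> \<in> proper_colourings H. colouring_monomial H \<beta> \<kappa> = m \<and>
       (\<forall>a\<in>verts H. \<forall>b\<in>verts H. R_rel G \<alpha> H \<beta> a b \<longrightarrow> \<kappa> a = \<kappa> b)}"
proof -
  \<comment> \<open>The restriction makes the pullback extensional; \<open>block_of\<close> is
    meaningful only on the vertices of \<open>H\<close>.\<close>
  define \<Phi> where "\<Phi> \<kappa> = restrict (\<kappa> \<circ> block_of) (verts H)" for \<kappa> :: "'v \<Rightarrow> nat"
  have gG: "edges_on (verts G) (edges G)" and gH: "edges_on (verts H) (edges H)"
    using wG wH by (auto simp: weighted_graph_def graph_def)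
  have edge: "Upair u v \<in># edges G \<longleftrightarrow>
      (\<exists>a\<in>R_set G \<alpha> H \<beta> u. \<exists>b\<in>R_set G \<alpha> H \<beta> v. Upair a b \<in># edges H)"
    if "u \<in> verts G" "v \<in> verts G" for u v
    using assms that by (simp add: expansion_def)
  have pull: "\<Phi> \<kappa> a = \<kappa> v" if "v \<in> verts G" "a \<in> R_set G \<alpha> H \<beta> v" for \<kappa> v a
    using that R_set_subset block_of_eq by (auto simp: \<Phi>_def)
  have mono_pull: "colouring_monomial H \<beta> (\<Phi> \<kappa>) = colouring_monomial G \<alpha> \<kappa>" for \<kappa>
    by (rule colouring_monomial_eq) (rule pull)
  \<comment> \<open>Both directions are used: right to left to land in the target, left to right for
    surjectivity. Extensionality is assumed because the pullback does not see \<kappa> outside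
    \<open>verts G\<close>.\<close>
  have proper: "\<Phi> \<kappa> \<in> proper_colourings H \<longleftrightarrow> \<kappa> \<in> proper_colourings G"
    if ext: "\<kappa> \<in> extensional (verts G)" for \<kappa>
  proof
    assume L: "\<Phi> \<kappa> \<in> proper_colourings H"
    have "\<kappa> v \<in> {1..}" if v: "v \<in> verts G" for v
    proof -
      obtain a where a: "a \<in> R_set G \<alpha> H \<beta> v" using R_set_nonempty[OF v] by blast
      then have "\<Phi> \<kappa> a \<in> {1..}"
        using L R_set_subset[OF v] by (auto simp: proper_colourings_def)
      then show ?thesis using pull[OF v a] by simp
    qed
    moreover have "\<kappa> u \<noteq> \<kappa> v" if e: "Upair u v \<in># edges G" for u v
    proof -
      have uv: "u \<in> verts G" "v \<in> verts G" using gG e by (auto simp: edges_on_def)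
      then obtain a b where "a \<in> R_set G \<alpha> H \<beta> u" "b \<in> R_set G \<alpha> H \<beta> v" "Upair a b \<in># edges H"
        using e edge by blast
      then show ?thesis
        using L pull uv by (auto simp: proper_colourings_def) metis
    qed
    ultimately show "\<kappa> \<in> proper_colourings G"
      using ext by (auto simp: proper_colourings_def PiE_iff)
  next
    assume R: "\<kappa> \<in> proper_colourings G"
    have "\<Phi> \<kappa> a \<noteq> \<Phi> \<kappa> b" if e: "Upair a b \<in># edges H" for a b
    proof -
      have ab: "a \<in> verts H" "b \<in> verts H" using gH e by (auto simp: edges_on_def)
      \<comment> \<open>If \<open>a\<close> and \<open>b\<close> lie in one block, this edge is a
        loop of \<open>G\<close>, which contradicts properness of \<kappa>; no separate case is
        required.\<close>
      then have "Upair (block_of a) (block_of b) \<in># edges G"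
        using e edge block_of by blast
      then show ?thesis using R ab by (auto simp: proper_colourings_def \<Phi>_def)
    qed
    then show "\<Phi> \<kappa> \<in> proper_colourings H"
      using R block_of(1) by (auto simp: proper_colourings_def \<Phi>_def PiE_iff)
  qed
  have "bij_betw \<Phi>
    {\<kappa> \<in> proper_colourings G. colouring_monomial G \<alpha> \<kappa> = m}
    {\<kappa> \<in> proper_colourings H. colouring_monomial H \<beta> \<kappa> = m \<and>
       (\<forall>a\<in>verts H. \<forall>b\<in>verts H. R_rel G \<alpha> H \<beta> a b \<longrightarrow> \<kappa> a = \<kappa> b)}"
    (is "bij_betw _ ?A ?B")
  proof (rule bij_betw_imageI)
    have extA: "\<kappa> \<in> extensional (verts G)" if "\<kappa> \<in> ?A" for \<kappa>
      using that by (auto simp: proper_colourings_def PiE_iff)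
    show "inj_on \<Phi> ?A"
    proof (rule inj_onI)
      fix \<kappa> \<mu> assume \<kappa>: "\<kappa> \<in> ?A" and \<mu>: "\<mu> \<in> ?A" and eq: "\<Phi> \<kappa> = \<Phi> \<mu>"
      have "\<kappa> v = \<mu> v" if v: "v \<in> verts G" for v
        using R_set_nonempty[OF v] pull[OF v] eq by (metis ex_in_conv)
      then show "\<kappa> = \<mu>" using extensionalityI[OF extA[OF \<kappa>] extA[OF \<mu>]] by blast
    qed
    show "\<Phi> ` ?A = ?B"
    proof (intro equalityI subsetI)
      fix \<mu> assume "\<mu> \<in> \<Phi> ` ?A"
      then obtain \<kappa> where \<kappa>: "\<kappa> \<in> ?A" "\<mu> = \<Phi> \<kappa>" by blast
      then show "\<mu> \<in> ?B"
        using proper[OF extA[OF \<kappa>(1)]] mono_pull by (auto simp: R_rel_iff_block_of) (simp add: \<Phi>_def)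
    next
      fix \<mu> assume \<mu>: "\<mu> \<in> ?B"
      \<comment> \<open>Any representative of the block will do, since \<mu> is constant on
        R-classes.\<close>
      define \<kappa> where "\<kappa> = restrict (\<lambda>v. \<mu> (SOME a. a \<in> R_set G \<alpha> H \<beta> v)) (verts G)"
      have "\<Phi> \<kappa> a = \<mu> a" if a: "a \<in> verts H" for a
      proof -
        let ?v = "block_of a"
        let ?b = "SOME b. b \<in> R_set G \<alpha> H \<beta> ?v"
        have b: "?b \<in> R_set G \<alpha> H \<beta> ?v"
          using block_of(2)[OF a] by (rule someI)
        then have "R_rel G \<alpha> H \<beta> ?b a" and "?b \<in> verts H"
          using block_of[OF a] R_set_subset unfolding R_rel_def by blast+
        then have "\<mu> ?b = \<mu> a" using \<mu> a by blast
        then show ?thesis using a block_of(1)[OF a] by (simp add: \<Phi>_def \<kappa>_def)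
      qed
      then have eq: "\<Phi> \<kappa> = \<mu>"
        using \<mu> by (intro extensionalityI[of _ "verts H"])
          (auto simp: \<Phi>_def proper_colourings_def PiE_iff)
      have "\<kappa> \<in> extensional (verts G)" by (simp add: \<kappa>_def)
      then have "\<kappa> \<in> ?A" using proper[of \<kappa>] mono_pull[of \<kappa>] \<mu> eq by simp
      then show "\<mu> \<in> \<Phi> ` ?A" using eq by blast
    qed
  qed
  then show ?thesis by (simp add: \<Phi>_def[abs_def])
qed

end

section \<open>The signed sum over edge sets, and components of the added edges\<close>

definition bichromatic :: "('v \<Rightarrow> 'c) \<Rightarrow> 'v uprod \<Rightarrow> bool" where
  "bichromatic \<kappa> e \<longleftrightarrow> (\<forall>u v. e = Upair u v \<longrightarrow> \<kappa> u \<noteq> \<kappa> v)"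

text \<open>Symmetry of the inequality makes the choice of orientation irrelevant. In particular a
  loop is never bichromatic.\<close>

lemma bichromatic_Upair: "bichromatic \<kappa> (Upair u v) \<longleftrightarrow> \<kappa> u \<noteq> \<kappa> v"
  by (auto simp: bichromatic_def)

lemma proper_colourings_iff_bichromatic:
  "\<kappa> \<in> proper_colourings G \<longleftrightarrow>
     \<kappa> \<in> verts G \<rightarrow>\<^sub>E {1..} \<and> (\<forall>e\<in>#edges G. bichromatic \<kappa> e)"
  by (auto simp: proper_colourings_def bichromatic_def)

lemma proper_colourings_add_edges:
  "\<kappa> \<in> proper_colourings (add_edges H S) \<longleftrightarrow>
     \<kappa> \<in> proper_colourings H \<and> (\<forall>e\<in>#S. bichromatic \<kappa> e)"
  by (auto simp: proper_colourings_iff_bichromatic add_edges_def)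

lemma colouring_monomial_add_edges [simp]:
  "colouring_monomial (add_edges H S) \<beta> \<kappa> = colouring_monomial H \<beta> \<kappa>"
  by (simp add: colouring_monomial_def add_edges_def)

lemma alternating_sum_chromatic_sf:
  assumes "weighted_graph H \<beta>"
  shows "(\<Sum>S\<in>Pow (copies E). (-1) ^ card S * chromatic_sf (add_edges H (uncopy S)) \<beta> m) =
    int (card {\<kappa> \<in> proper_colourings H. colouring_monomial H \<beta> \<kappa> = m \<and>
      (\<forall>e\<in>#E. \<not> bichromatic \<kappa> e)})"
proof -
  define K where "K = {\<kappa> \<in> proper_colourings H. colouring_monomial H \<beta> \<kappa> = m}"
  \<comment> \<open>A colouring in \<open>K\<close> stays proper after adding \<open>S\<close>
    exactly when \<open>S\<close> is contained in \<open>N \<kappa>\<close>, so each coefficient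
    becomes a sum of indicators over the fixed finite set \<open>K\<close>.\<close>
  define N where "N \<kappa> = {c \<in> copies E. bichromatic \<kappa> (fst c)}" for \<kappa> :: "'a \<Rightarrow> nat"
  have finK: "finite K" unfolding K_def by (rule finite_colourings_of_monomial[OF assms])
  have finN: "finite (N \<kappa>)" for \<kappa> by (simp add: N_def finite_copies)
  have coeff: "chromatic_sf (add_edges H (uncopy S)) \<beta> m = (\<Sum>\<kappa>\<in>K. of_bool (S \<subseteq> N \<kappa>))"
    if S: "S \<in> Pow (copies E)" for S
  proof -
    have "finite S" using S finite_copies finite_subset by blast
    then have "{\<kappa> \<in> proper_colourings (add_edges H (uncopy S)).
        colouring_monomial (add_edges H (uncopy S)) \<beta> \<kappa> = m} = {\<kappa> \<in> K. S \<subseteq> N \<kappa>}"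
      using S by (auto simp: proper_colourings_add_edges set_mset_uncopy K_def N_def)
    then show ?thesis using finK by (simp add: chromatic_sf_def of_bool_def sum.If_cases Int_def)
  qed
  have "(\<Sum>S\<in>Pow (copies E). (-1) ^ card S * chromatic_sf (add_edges H (uncopy S)) \<beta> m) =
      (\<Sum>S\<in>Pow (copies E). \<Sum>\<kappa>\<in>K. (-1) ^ card S * of_bool (S \<subseteq> N \<kappa>))"
    by (simp add: coeff sum_distrib_left)
  also have "\<dots> = (\<Sum>\<kappa>\<in>K. \<Sum>S\<in>Pow (copies E). (-1) ^ card S * of_bool (S \<subseteq> N \<kappa>))"
    by (rule sum.swap)
  also have "\<dots> = (\<Sum>\<kappa>\<in>K. \<Sum>S\<in>Pow (N \<kappa>). (-1) ^ card S)"
  proof (rule sum.cong[OF refl])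
    fix \<kappa>
    show "(\<Sum>S\<in>Pow (copies E). (-1) ^ card S * of_bool (S \<subseteq> N \<kappa>)) =
        (\<Sum>S\<in>Pow (N \<kappa>). (-1) ^ card S :: int)"
      \<comment> \<open>Sets of copies not contained in \<open>N \<kappa>\<close> contribute
        0.\<close>
      by (rule sum.mono_neutral_cong_right) (auto simp: finite_copies N_def)
  qed
  also have "\<dots> = (\<Sum>\<kappa>\<in>K. if N \<kappa> = {} then 1 else 0)"
    by (simp add: sum_Pow_minus_one_power_card finN)
  also have "\<dots> = int (card {\<kappa> \<in> K. N \<kappa> = {}})"
    using finK by (simp add: sum.If_cases Int_def)
  \<comment> \<open>Every edge in \<open>E\<close> has at least one copy, so passing from copies to
    edges loses nothing.\<close>
  also have "{\<kappa> \<in> K. N \<kappa> = {}} = {\<kappa> \<in> K. \<forall>e\<in>#E. \<not> bichromatic \<kappa> e}"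
    unfolding fst_copies[symmetric] by (auto simp: N_def)
  finally show ?thesis by (simp add: K_def conj_assoc)
qed

text \<open>Equality of colours along edges propagates along paths by induction; conversely, the two
  ends of an edge lie in one component.\<close>

lemma constant_on_components_iff:
  assumes "edges_on (verts H) E"
  shows "(\<forall>e\<in>#E. \<not> bichromatic \<kappa> e) \<longleftrightarrow>
    (\<forall>a\<in>verts H. \<forall>b\<in>verts H. same_component \<lparr>vlist = vlist H, edges = E\<rparr> a b \<longrightarrow> \<kappa> a = \<kappa> b)"
proof
  assume L: "\<forall>e\<in>#E. \<not> bichromatic \<kappa> e"
  have "\<kappa> a = \<kappa> b" if "(a, b) \<in> {(u, v). Upair u v \<in># E}\<^sup>*" for a b
    using that
  proof (induction rule: rtrancl_induct)
    case (step b c)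
    then have "Upair b c \<in># E" by simp
    then have "\<kappa> b = \<kappa> c" using L bichromatic_Upair by metis
    then show ?case using step.IH by simp
  qed simp
  then show "\<forall>a\<in>verts H. \<forall>b\<in>verts H.
      same_component \<lparr>vlist = vlist H, edges = E\<rparr> a b \<longrightarrow> \<kappa> a = \<kappa> b"
    by (simp add: same_component_def)
next
  assume R: "\<forall>a\<in>verts H. \<forall>b\<in>verts H.
      same_component \<lparr>vlist = vlist H, edges = E\<rparr> a b \<longrightarrow> \<kappa> a = \<kappa> b"
  have "\<not> bichromatic \<kappa> (Upair a b)" if e: "Upair a b \<in># E" for a b
  proof -
    have ab: "a \<in> verts H" "b \<in> verts H" using assms e by (auto simp: edges_on_def)
    moreover have "same_component \<lparr>vlist = vlist H, edges = E\<rparr> a b"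
      using ab e by (auto simp: same_component_def)
    ultimately show ?thesis using R by (simp add: bichromatic_Upair)
  qed
  then show "\<forall>e\<in>#E. \<not> bichromatic \<kappa> e" by (metis uprod_exhaust)
qed

theorem theorem3p5:
  fixes G :: "'v lgraph" and H :: "'w lgraph" and \<alpha> \<beta> :: "nat list"
    and E' :: "'w uprod multiset"
  assumes "weighted_graph G \<alpha>"
    and "weighted_graph H \<beta>"
    and "expansion H \<beta> G \<alpha>"
    and "edges_on (verts H) E'"
    and "\<And>a b. a \<in> verts H \<Longrightarrow> b \<in> verts H \<Longrightarrow>
           same_component \<lparr>vlist = vlist H, edges = E'\<rparr> a b \<longleftrightarrow> R_rel G \<alpha> H \<beta> a b"
  shows "chromatic_sf G \<alpha> =
           (\<lambda>m. \<Sum>S\<in>Pow (copies E'). (-1) ^ card S * chromatic_sf (add_edges H (uncopy S)) \<beta> m)"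
proof
  fix m
  \<comment> \<open>By \<open>coarsening_blocks_unique\<close> this witness is the only possible
    cut.\<close>
  obtain bs where "coarsening_blocks bs \<beta> \<alpha>"
    using assms(3) by (auto simp: expansion_def refines_def)
  then interpret coarsened_graph G H \<alpha> \<beta> bs
    using assms(1,2) by unfold_locales
  \<comment> \<open>The hypothesis on components identifies the colourings that survive the
    cancellation with those constant on each R(v), which the pullback bijection counts.\<close>
  have "(\<forall>e\<in>#E'. \<not> bichromatic \<kappa> e) \<longleftrightarrow>
      (\<forall>a\<in>verts H. \<forall>b\<in>verts H. R_rel G \<alpha> H \<beta> a b \<longrightarrow> \<kappa> a = \<kappa> b)" for \<kappa> :: "'w \<Rightarrow> nat"
    unfolding constant_on_components_iff[OF assms(4)] using assms(5) by simp
  then show "chromatic_sf G \<alpha> m =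
      (\<Sum>S\<in>Pow (copies E'). (-1) ^ card S * chromatic_sf (add_edges H (uncopy S)) \<beta> m)"
    unfolding alternating_sum_chromatic_sf[OF assms(2)]
    using bij_betw_same_card[OF bij_betw_pullback_colourings[OF assms(3), of m]]
    by (simp add: chromatic_sf_def)
qed

end
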